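(* Let $q\in(0,1)$ and let $J_q(\,\cdot\,)=J_q(\,\cdot\,;a_{(J)},b)$ be any one of the three $q$-integrals $G_q(\,\cdot\,;bq^n,b)$, $I_q(\,\cdot\,;0,b)$, $R_q(\,\cdot\,;a,b)$ described in the context, with interval of integration $E_{(J)}=[a_{(J)},b]$. Let $f,g:E_{(J)}\to\mathbb{R}$ be two positive functions and $p\ne0$ a real number, and assume that the $q$-integrals $J_q(fg)$, $J_q(f^2)$, $J_q(f^{2-p}g^p)$ exist. Then $$\bigl(J_q(fg)\bigr)^p\le\bigl(J_q(f^2)\bigr)^{p-1}J_q(f^{2-p}g^p)\quad\text{if }p\notin(0,1),$$ $$\bigl(J_q(fg)\bigr)^p\ge\bigl(J_q(f^2)\bigr)^{p-1}J_q(f^{2-p}g^p)\quad\text{if }p\in(0,1).$$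
   Context: Let $q\in(0,1)$. The three types of $q$-integral are: (G) restricted $q$-integral: for $b>0$, a positive integer $n$ and $a=bq^n$, $G_q(h;a,b)=b(1-q)\sum_{k=0}^{n-1}h(bq^k)q^k$; here $a_{(J)}=bq^n$. (I) for $b>0$, $I_q(h;0,b)=b(1-q)\sum_{k=0}^{\infty}h(bq^k)q^k$; here $a_{(J)}=0$. (R) Riemann-type $q$-integral: for $0<a<b$, $R_q(h;a,b)=(b-a)(1-q)\sum_{k=0}^{\infty}h\bigl(a+(b-a)q^k\bigr)q^k$; here $a_{(J)}=a$. In each case $E_{(J)}=[a_{(J)},b]$. A $q$-integral of type (I) or (R) is said to exist if the defining series converges (type (G) always exists). "Positive" means strictly positive at every point of the domain. *)

theory Defs
  imports Complex_Main
begin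

text \<open>
  The restricted integral is taken over \<open>[b * q^n, b]\<close>, so its lower endpoint is determined by \<open>n\<close>.
\<close>

definition qint_G :: "real \<Rightarrow> (real \<Rightarrow> real) \<Rightarrow> nat \<Rightarrow> real \<Rightarrow> real" where
  "qint_G q h n b = b * (1 - q) * (\<Sum>k<n. h (b * q ^ k) * q ^ k)"

definition qint_I :: "real \<Rightarrow> (real \<Rightarrow> real) \<Rightarrow> real \<Rightarrow> real" where
  "qint_I q h b = b * (1 - q) * (\<Sum>k. h (b * q ^ k) * q ^ k)"

definition qint_R :: "real \<Rightarrow> (real \<Rightarrow> real) \<Rightarrow> real \<Rightarrow> real \<Rightarrow> real" where
  "qint_R q h a b = (b - a) * (1 - q) * (\<Sum>k. h (a + (b - a) * q ^ k) * q ^ k)"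

text \<open>
  The three types of integral, each carrying the parameter (besides \<open>q\<close> and the upper endpoint \<open>b\<close>)
  that determines its lower endpoint.
\<close>

datatype qint_type = Type_G nat | Type_I | Type_R real

fun qint_admissible :: "qint_type \<Rightarrow> real \<Rightarrow> bool" where
  "qint_admissible (Type_G n) b \<longleftrightarrow> 0 < b \<and> 0 < n"
| "qint_admissible Type_I b \<longleftrightarrow> 0 < b"
| "qint_admissible (Type_R a) b \<longleftrightarrow> 0 < a \<and> a < b"

fun qint_lower :: "real \<Rightarrow> qint_type \<Rightarrow> real \<Rightarrow> real" where
  "qint_lower q (Type_G n) b = b * q ^ n"
| "qint_lower q Type_I b = 0"
| "qint_lower q (Type_R a) b = a"

definition qint_domain :: "real \<Rightarrow> qint_type \<Rightarrow> real \<Rightarrow> real set" where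
  "qint_domain q J b = {qint_lower q J b..b}"

fun qint :: "real \<Rightarrow> qint_type \<Rightarrow> real \<Rightarrow> (real \<Rightarrow> real) \<Rightarrow> real" where
  "qint q (Type_G n) b h = qint_G q h n b"
| "qint q Type_I b h = qint_I q h b"
| "qint q (Type_R a) b h = qint_R q h a b"

fun qint_exists :: "real \<Rightarrow> qint_type \<Rightarrow> real \<Rightarrow> (real \<Rightarrow> real) \<Rightarrow> bool" where
  "qint_exists q (Type_G n) b h \<longleftrightarrow> True"
| "qint_exists q Type_I b h \<longleftrightarrow> summable (\<lambda>k. h (b * q ^ k) * q ^ k)"
| "qint_exists q (Type_R a) b h \<longleftrightarrow> summable (\<lambda>k. h (a + (b - a) * q ^ k) * q ^ k)"

end

theory Submission
  imports Defs "HOL-Analysis.Convex"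
begin

text \<open>
  A \<open>q\<close>-integral is a sum with positive weights over nodes in its domain, hence a positive linear
  functional \<open>L\<close>, and the claim is Jensen's inequality for \<open>t \<mapsto> t powr p\<close>, applied to the ratio
  \<open>r = g / f\<close> with respect to the functional \<open>h \<mapsto> L (f\<^sup>2 * h)\<close>. Put \<open>A = L (f * g)\<close>,
  \<open>B = L (f\<^sup>2)\<close>, \<open>C = L (f powr (2 - p) * g powr p)\<close> and \<open>m = A / B\<close>. For \<open>p \<notin> (0, 1)\<close> the power
  lies above its tangent at \<open>m\<close>; multiplying that inequality at \<open>r\<close> by \<open>f\<^sup>2\<close> gives, pointwise,
  \<open>p * m powr (p - 1) * (f * g) + (1 - p) * m powr p * f\<^sup>2 \<le> f powr (2 - p) * g powr p\<close>.
  Applying \<open>L\<close> and \<open>A = m * B\<close> yields \<open>m powr p * B \<le> C\<close>, which is the claim. For \<open>p \<in> (0, 1)\<close>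
  all inequalities are reversed. Both cases are treated at once by means of a factor \<open>\<epsilon>\<close> with
  \<open>0 \<le> \<epsilon> * (p * (p - 1))\<close>, which makes \<open>t \<mapsto> \<epsilon> * t powr p\<close> convex.
\<close>

lemma powr_above_tangent:
  fixes \<epsilon> p m r :: real
  assumes "0 \<le> \<epsilon> * (p * (p - 1))" and "0 < m" and "0 < r"
  shows "\<epsilon> * (p * m powr (p - 1) * (r - m)) \<le> \<epsilon> * (r powr p - m powr p)"
proof -
  have "\<epsilon> * (p * m powr (p - 1)) * (r - m) \<le> \<epsilon> * r powr p - \<epsilon> * m powr p"
  proof (rule f''_imp_f'[where C = "{0<..}"
        and f'' = "\<lambda>t. \<epsilon> * (p * ((p - 1) * t powr (p - 1 - 1)))"])
    fix x :: real
    assume "x \<in> {0<..}"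
    then have x: "0 < x" by simp
    show "((\<lambda>t. \<epsilon> * t powr p) has_real_derivative \<epsilon> * (p * x powr (p - 1))) (at x)"
      by (intro DERIV_cmult has_real_derivative_powr x)
    show "((\<lambda>t. \<epsilon> * (p * t powr (p - 1))) has_real_derivative
        \<epsilon> * (p * ((p - 1) * x powr (p - 1 - 1)))) (at x)"
      by (intro DERIV_cmult has_real_derivative_powr x)
    have "0 \<le> \<epsilon> * (p * (p - 1)) * x powr (p - 1 - 1)"
      by (rule mult_nonneg_nonneg[OF assms(1)]) simp
    then show "0 \<le> \<epsilon> * (p * ((p - 1) * x powr (p - 1 - 1)))"
      by (simp only: mult.assoc)
  qed (use assms in simp_all)
  then show ?thesis by (simp add: right_diff_distrib mult.assoc)
qed

text \<open>The tangent inequality at the ratio \<open>v / u\<close>, multiplied by \<open>u\<^sup>2\<close>.\<close>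

lemma powr_above_tangent_homogeneous:
  fixes \<epsilon> p m u v :: real
  assumes "0 \<le> \<epsilon> * (p * (p - 1))" and m: "0 < m" and u: "0 < u" and v: "0 < v"
  shows "\<epsilon> * (p * m powr (p - 1)) * (u * v) + \<epsilon> * ((1 - p) * m powr p) * u\<^sup>2
    \<le> \<epsilon> * (u powr (2 - p) * v powr p)"
proof -
  have pow: "u\<^sup>2 * (v / u) powr p = u powr (2 - p) * v powr p"
  proof -
    have "u powr (2 - p) = u\<^sup>2 / u powr p"
      using u by (simp add: powr_diff)
    then show ?thesis using u v by (simp add: powr_divide)
  qed
  have mp: "m powr (p - 1) * m = m powr p"
    using m by (simp add: powr_diff)
  have "\<epsilon> * (p * m powr (p - 1)) * (u * v) + \<epsilon> * ((1 - p) * m powr p) * u\<^sup>2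
      = u\<^sup>2 * (\<epsilon> * (p * m powr (p - 1) * (v / u - m))) + u\<^sup>2 * (\<epsilon> * m powr p)"
    unfolding mp[symmetric] using u by (simp add: field_simps power2_eq_square)
  also have "\<dots> \<le> u\<^sup>2 * (\<epsilon> * ((v / u) powr p - m powr p)) + u\<^sup>2 * (\<epsilon> * m powr p)"
    using assms by (intro add_right_mono mult_left_mono powr_above_tangent) simp_all
  also have "\<dots> = \<epsilon> * (u\<^sup>2 * (v / u) powr p)"
    by (simp add: algebra_simps)
  finally show ?thesis by (simp only: pow)
qed

lemma qint_lincomb:
  assumes "qint_exists q J b h" and "qint_exists q J b k"
  shows "qint_exists q J b (\<lambda>x. c * h x + d * k x)"
    and "qint q J b (\<lambda>x. c * h x + d * k x) = c * qint q J b h + d * qint q J b k"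
proof -
  have *: "summable (\<lambda>i. (c * F i + d * G i) * q ^ i)"
      "(\<Sum>i. (c * F i + d * G i) * q ^ i) = c * (\<Sum>i. F i * q ^ i) + d * (\<Sum>i. G i * q ^ i)"
    if "summable (\<lambda>i. F i * q ^ i)" "summable (\<lambda>i. G i * q ^ i)" for F G :: "nat \<Rightarrow> real"
  proof -
    have "(\<lambda>i. c * (F i * q ^ i) + d * (G i * q ^ i)) sums
        (c * (\<Sum>i. F i * q ^ i) + d * (\<Sum>i. G i * q ^ i))"
      by (intro sums_add sums_mult summable_sums that)
    then have "(\<lambda>i. (c * F i + d * G i) * q ^ i) sums
        (c * (\<Sum>i. F i * q ^ i) + d * (\<Sum>i. G i * q ^ i))"
      by (simp add: distrib_right mult.assoc)
    then show "summable (\<lambda>i. (c * F i + d * G i) * q ^ i)"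
      "(\<Sum>i. (c * F i + d * G i) * q ^ i) = c * (\<Sum>i. F i * q ^ i) + d * (\<Sum>i. G i * q ^ i)"
      by (auto simp: sums_iff)
  qed
  show "qint_exists q J b (\<lambda>x. c * h x + d * k x)"
    using assms by (cases J) (simp_all add: *)
  show "qint q J b (\<lambda>x. c * h x + d * k x) = c * qint q J b h + d * qint q J b k"
  proof (cases J)
    case (Type_G n)
    then show ?thesis
      by (simp add: qint_G_def sum_distrib_left sum.distrib algebra_simps)
  next
    case Type_I
    then show ?thesis
      using assms by (simp add: qint_I_def * distrib_left)
  next
    case (Type_R a)
    then show ?thesis
      using assms by (simp add: qint_R_def * distrib_left)
  qed
qed

lemma qint_node_mem:
  assumes "0 < q" and "q < 1"
  shows "qint_admissible (Type_G n) b \<Longrightarrow> i < n \<Longrightarrow> b * q ^ i \<in> qint_domain q (Type_G n) b"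
    and "qint_admissible Type_I b \<Longrightarrow> b * q ^ i \<in> qint_domain q Type_I b"
    and "qint_admissible (Type_R a) b \<Longrightarrow> a + (b - a) * q ^ i \<in> qint_domain q (Type_R a) b"
proof -
  have le1: "q ^ i \<le> 1" and pos: "0 < q ^ i"
    using assms by (simp_all add: power_le_one)
  show "b * q ^ i \<in> qint_domain q (Type_G n) b" if J: "qint_admissible (Type_G n) b" and i: "i < n"
  proof -
    have "q ^ n \<le> q ^ i"
      using assms i by (intro power_decreasing) simp_all
    then show ?thesis
      using J le1 by (simp add: qint_domain_def mult_left_le)
  qed
  show "b * q ^ i \<in> qint_domain q Type_I b" if J: "qint_admissible Type_I b"
    using J le1 pos by (simp add: qint_domain_def mult_left_le)
  show "a + (b - a) * q ^ i \<in> qint_domain q (Type_R a) b" if J: "qint_admissible (Type_R a) b"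
  proof -
    have "(b - a) * q ^ i \<le> b - a"
      using J le1 by (intro mult_left_le) simp_all
    then have "a + (b - a) * q ^ i \<le> b" by linarith
    then show ?thesis
      using J pos by (simp add: qint_domain_def)
  qed
qed

lemma qint_mono:
  assumes q: "0 < q" "q < 1" and "qint_admissible J b"
    and "qint_exists q J b h" and "qint_exists q J b k"
    and "\<And>x. x \<in> qint_domain q J b \<Longrightarrow> h x \<le> k x"
  shows "qint q J b h \<le> qint q J b k"
  using assms(3-)
proof (induction J)
  case (Type_G n)
  show ?case
    unfolding qint.simps qint_G_def
    using q Type_G(1-3)
    by (intro mult_left_mono sum_mono mult_right_mono Type_G(4) qint_node_mem(1)) auto
next
  case Type_I
  show ?case
    unfolding qint.simps qint_I_def
    using q Type_I(1-3)
    by (intro mult_left_mono suminf_le mult_right_mono Type_I(4) qint_node_mem(2)) auto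
next
  case (Type_R a)
  show ?case
    unfolding qint.simps qint_R_def
    using q Type_R(1-3)
    by (intro mult_left_mono suminf_le mult_right_mono Type_R(4) qint_node_mem(3)) auto
qed

lemma qint_pos:
  assumes q: "0 < q" "q < 1" and "qint_admissible J b"
    and "qint_exists q J b h"
    and "\<And>x. x \<in> qint_domain q J b \<Longrightarrow> 0 < h x"
  shows "0 < qint q J b h"
  using assms(3-)
proof (induction J)
  case (Type_G n)
  show ?case
    unfolding qint.simps qint_G_def
    using q Type_G(1-2)
    by (intro mult_pos_pos sum_pos Type_G(3) qint_node_mem(1)) auto
next
  case Type_I
  show ?case
    unfolding qint.simps qint_I_def
    using q Type_I(1-2)
    by (intro mult_pos_pos suminf_pos Type_I(3) qint_node_mem(2)) auto
next
  case (Type_R a)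
  show ?case
    unfolding qint.simps qint_R_def
    using q Type_R(1-2)
    by (intro mult_pos_pos suminf_pos Type_R(3) qint_node_mem(3)) auto
qed

text \<open>
  Both directions of the inequality in one: the condition on \<open>\<epsilon>\<close> holds with \<open>\<epsilon> = 1\<close> for
  \<open>p \<notin> (0, 1)\<close>, and with \<open>\<epsilon> = -1\<close> for \<open>p \<in> [0, 1]\<close>.
\<close>

lemma qint_powr_le:
  fixes q b p \<epsilon> :: real and f g :: "real \<Rightarrow> real"
  assumes q: "0 < q" "q < 1" and J: "qint_admissible J b"
    and f: "\<And>x. x \<in> qint_domain q J b \<Longrightarrow> 0 < f x"
    and g: "\<And>x. x \<in> qint_domain q J b \<Longrightarrow> 0 < g x"
    and exA: "qint_exists q J b (\<lambda>x. f x * g x)"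
    and exB: "qint_exists q J b (\<lambda>x. (f x)\<^sup>2)"
    and exC: "qint_exists q J b (\<lambda>x. f x powr (2 - p) * g x powr p)"
    and \<epsilon>: "0 \<le> \<epsilon> * (p * (p - 1))"
  shows "\<epsilon> * qint q J b (\<lambda>x. f x * g x) powr p
    \<le> \<epsilon> * (qint q J b (\<lambda>x. (f x)\<^sup>2) powr (p - 1)
        * qint q J b (\<lambda>x. f x powr (2 - p) * g x powr p))"
proof -
  define A where "A = qint q J b (\<lambda>x. f x * g x)"
  define B where "B = qint q J b (\<lambda>x. (f x)\<^sup>2)"
  define C where "C = qint q J b (\<lambda>x. f x powr (2 - p) * g x powr p)"
  define m where "m = A / B"
  have A: "0 < A"
    unfolding A_def using f g by (intro qint_pos q J exA) simp
  have B: "0 < B"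
    unfolding B_def using f by (intro qint_pos q J exB) (metis zero_less_power)
  have m: "0 < m" using A B by (simp add: m_def)
  have Am: "A = m * B" using B by (simp add: m_def)
  let ?l = "\<lambda>x. \<epsilon> * (p * m powr (p - 1)) * (f x * g x) + \<epsilon> * ((1 - p) * m powr p) * (f x)\<^sup>2"
  \<comment> \<open>the zero term makes the right-hand side a linear combination as well\<close>
  let ?r = "\<lambda>x. \<epsilon> * (f x powr (2 - p) * g x powr p) + 0 * (f x)\<^sup>2"
  have "qint q J b ?l \<le> qint q J b ?r"
  proof (rule qint_mono[OF q J])
    show "qint_exists q J b ?l" by (rule qint_lincomb(1)[OF exA exB])
    show "qint_exists q J b ?r" by (rule qint_lincomb(1)[OF exC exB])
    show "?l x \<le> ?r x" if "x \<in> qint_domain q J b" for x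
      using powr_above_tangent_homogeneous[OF \<epsilon> m f[OF that] g[OF that]] by simp
  qed
  then have "\<epsilon> * (p * m powr (p - 1)) * A + \<epsilon> * ((1 - p) * m powr p) * B \<le> \<epsilon> * C"
    unfolding qint_lincomb(2)[OF exA exB] qint_lincomb(2)[OF exC exB] A_def B_def C_def
    by simp
  moreover have "m powr p = m powr (p - 1) * m"
    using m by (simp add: powr_diff)
  ultimately have "\<epsilon> * (m powr p * B) \<le> \<epsilon> * C"
    by (simp add: Am algebra_simps)
  then have "B powr (p - 1) * (\<epsilon> * (m powr p * B)) \<le> B powr (p - 1) * (\<epsilon> * C)"
    by (rule mult_left_mono) simp
  moreover have "B powr (p - 1) * (m powr p * B) = A powr p"
    using A B by (simp add: m_def powr_divide powr_diff)
  ultimately have "\<epsilon> * A powr p \<le> \<epsilon> * (B powr (p - 1) * C)"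
    by (simp add: mult.left_commute)
  then show ?thesis by (simp only: A_def B_def C_def)
qed

theorem theorem6p6:
  fixes q b p :: real and J :: qint_type and f g :: "real \<Rightarrow> real"
  assumes "0 < q" and "q < 1"
    and "qint_admissible J b"
    and "\<And>x. x \<in> qint_domain q J b \<Longrightarrow> 0 < f x"
    and "\<And>x. x \<in> qint_domain q J b \<Longrightarrow> 0 < g x"
    and "p \<noteq> 0"
    and "qint_exists q J b (\<lambda>x. f x * g x)"
    and "qint_exists q J b (\<lambda>x. (f x)\<^sup>2)"
    and "qint_exists q J b (\<lambda>x. f x powr (2 - p) * g x powr p)"
  shows "(p \<notin> {0<..<1} \<longrightarrow>
            qint q J b (\<lambda>x. f x * g x) powr p
              \<le> qint q J b (\<lambda>x. (f x)\<^sup>2) powr (p - 1)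
                 * qint q J b (\<lambda>x. f x powr (2 - p) * g x powr p))
       \<and> (p \<in> {0<..<1} \<longrightarrow>
            qint q J b (\<lambda>x. f x * g x) powr p
              \<ge> qint q J b (\<lambda>x. (f x)\<^sup>2) powr (p - 1)
                 * qint q J b (\<lambda>x. f x powr (2 - p) * g x powr p))"
proof (intro conjI impI)
  assume "p \<notin> {0<..<1}"
  then have "0 \<le> 1 * (p * (p - 1))"
    by (auto simp: zero_le_mult_iff)
  from qint_powr_le[OF assms(1-5,7-9) this]
  show "qint q J b (\<lambda>x. f x * g x) powr p
      \<le> qint q J b (\<lambda>x. (f x)\<^sup>2) powr (p - 1)
        * qint q J b (\<lambda>x. f x powr (2 - p) * g x powr p)"
    by simp
next
  assume "p \<in> {0<..<1}"
  then have "0 \<le> - 1 * (p * (p - 1))"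
    by (simp add: mult_le_0_iff)
  from qint_powr_le[OF assms(1-5,7-9) this]
  show "qint q J b (\<lambda>x. f x * g x) powr p
      \<ge> qint q J b (\<lambda>x. (f x)\<^sup>2) powr (p - 1)
        * qint q J b (\<lambda>x. f x powr (2 - p) * g x powr p)"
    by simp
qed

end
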